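(* If the Reeb vector field $\xi$ of a three-dimensional paracontact metric manifold $(M,\varphi,\xi,\eta,g)$ is affine Killing, then $\xi$ is Killing (and so, $M$ is paraSasakian).
   Context: An almost paracontact structure on a connected smooth manifold $M$ of dimension $3$ is a triple $(\varphi,\xi,\eta)$ of a $(1,1)$-tensor, a global vector field and a $1$-form with $\varphi(\xi)=0$, $\eta\circ\varphi=0$, $\eta(\xi)=1$, $\varphi^2=\mathrm{Id}-\eta\otimes\xi$, and such that the $\pm1$-eigenbundles of $\varphi|_{\ker\eta}$ both have rank $1$. A pseudo-Riemannian metric $g$ is compatible if $g(\varphi X,\varphi Y)=-g(X,Y)+\eta(X)\eta(Y)$; then $(\varphi,\xi,\eta,g)$ is an almost paracontact metric structure and $\eta=g(\xi,\cdot)$. It is a paracontact metric structure if $d\eta(X,Y)=g(X,\varphi Y)$ for all $X,Y$, with the convention $d\eta(X,Y)=\frac12\big(X\eta(Y)-Y\eta(X)-\eta([X,Y])\big)$. $\xi$ is called the Reeb vector field. The structure is normal if $[\varphi,\varphi]-2d\eta\otimes\xi=0$, where $[\varphi,\varphi]$ is the Nijenhuis torsion of $\varphi$; a paraSasakian manifold is a normal paracontact metric manifold. A vector field $V$ is affine Killing if $\mathcal L_V\nabla=0$, where $\nabla$ is the Levi-Civita connection and $(\mathcal L_V\nabla)(X,Y)=\mathcal L_V(\nabla_XY)-\nabla_{\mathcal L_VX}Y-\nabla_X(\mathcal L_VY)$; it is Killing if $\mathcal L_Vg=0$. *)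

theory Defs
  imports "HOL-Analysis.Analysis" "HOL-Library.Function_Algebras"
begin

(* Tangent vectors are functionals on real functions; with this instance they, and fields of
   them, form real vector spaces, so that +, -, subspace and dim are available. *)

instantiation "fun" :: (type, scaleR) scaleR
begin

definition scaleR_fun_def: "scaleR c f = (\<lambda>x. c *\<^sub>R f x)"

instance ..

end

lemma scaleR_fun_apply [simp]: "(c *\<^sub>R f) x = c *\<^sub>R f x"
  by (simp add: scaleR_fun_def)

instance "fun" :: (type, real_vector) real_vector
  by standard (simp_all add: fun_eq_iff algebra_simps)


section \<open>Smooth manifolds\<close>

(* Meant for open U; then only the values of f on U matter. *)

primrec Ck_on :: "nat \<Rightarrow> 'a::real_normed_vector set \<Rightarrow> ('a \<Rightarrow> 'b::real_normed_vector) \<Rightarrow> bool" where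
  "Ck_on 0 U f \<longleftrightarrow> continuous_on U f"
| "Ck_on (Suc k) U f \<longleftrightarrow>
     (\<forall>x\<in>U. f differentiable at x) \<and> (\<forall>v. Ck_on k U (\<lambda>x. frechet_derivative f (at x) v))"

definition smooth_on :: "'a::real_normed_vector set \<Rightarrow> ('a \<Rightarrow> 'b::real_normed_vector) \<Rightarrow> bool" where
  "smooth_on U f \<longleftrightarrow> (\<forall>k. Ck_on k U f)"

(* A chart is a pair of a domain and a coordinate map; the values of the map off its domain are
   irrelevant.  The manifold is the whole type 'a, so its Hausdorff and second countability
   axioms are sort constraints; its dimension is CARD('n).  The atlas need not be maximal. *)

type_synonym ('a, 'n) chart = "'a set \<times> ('a \<Rightarrow> real ^ 'n)"

definition smooth_atlas ::
    "('a::{t2_space, second_countable_topology}, 'n::finite) chart set \<Rightarrow> bool" where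
  "smooth_atlas A \<longleftrightarrow>
     (\<forall>(U, x)\<in>A. open U \<and> open (x ` U) \<and> homeomorphism U (x ` U) x (inv_into U x)) \<and>
     (\<Union>(U, x)\<in>A. U) = UNIV \<and>
     (\<forall>(U, x)\<in>A. \<forall>(V, y)\<in>A. smooth_on (x ` (U \<inter> V)) (y \<circ> inv_into U x))"

definition connected_smooth_manifold ::
    "('a::{t2_space, second_countable_topology}, 'n::finite) chart set \<Rightarrow> bool" where
  "connected_smooth_manifold A \<longleftrightarrow> smooth_atlas A \<and> connected (UNIV :: 'a set)"

definition smooth_functions :: "('a, 'n::finite) chart set \<Rightarrow> ('a \<Rightarrow> real) set" where
  "smooth_functions A = {f. \<forall>(U, x)\<in>A. smooth_on (x ` U) (f \<circ> inv_into U x)}"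


section \<open>Tangent vectors and tensor fields\<close>

(* Derivations at p of the algebra of smooth functions.  The last clause makes a derivation a
   unique total function. *)

type_synonym 'a tangent = "('a \<Rightarrow> real) \<Rightarrow> real"

definition tangent_space :: "('a, 'n::finite) chart set \<Rightarrow> 'a \<Rightarrow> 'a tangent set" where
  "tangent_space A p = {v.
     (\<forall>f\<in>smooth_functions A. \<forall>g\<in>smooth_functions A. v (f + g) = v f + v g) \<and>
     (\<forall>c. \<forall>f\<in>smooth_functions A. v (c *\<^sub>R f) = c * v f) \<and>
     (\<forall>f\<in>smooth_functions A. \<forall>g\<in>smooth_functions A. v (f * g) = v f * g p + f p * v g) \<and>
     (\<forall>f. f \<notin> smooth_functions A \<longrightarrow> v f = 0)}"

type_synonym 'a vfield = "'a \<Rightarrow> 'a tangent"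

definition deriv_along :: "'a vfield \<Rightarrow> ('a \<Rightarrow> real) \<Rightarrow> 'a \<Rightarrow> real" where
  "deriv_along X f = (\<lambda>p. X p f)"

definition vector_fields :: "('a, 'n::finite) chart set \<Rightarrow> 'a vfield set" where
  "vector_fields A = {X. (\<forall>p. X p \<in> tangent_space A p) \<and>
     (\<forall>f\<in>smooth_functions A. deriv_along X f \<in> smooth_functions A)}"

definition fmult :: "('a \<Rightarrow> real) \<Rightarrow> 'a vfield \<Rightarrow> 'a vfield" where
  "fmult f X = (\<lambda>p. f p *\<^sub>R X p)"

(* For vector fields X, Y and a non-smooth f, both terms are the derivative of 0, so the bracket
   again vanishes on f. *)

definition lie_bracket :: "'a vfield \<Rightarrow> 'a vfield \<Rightarrow> 'a vfield" where
  "lie_bracket X Y = (\<lambda>p f. X p (deriv_along Y f) - Y p (deriv_along X f))"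

definition lin_on :: "'v::real_vector set \<Rightarrow> ('v \<Rightarrow> 'w::real_vector) \<Rightarrow> bool" where
  "lin_on S h \<longleftrightarrow> (\<forall>v\<in>S. \<forall>w\<in>S. h (v + w) = h v + h w) \<and> (\<forall>c. \<forall>v\<in>S. h (c *\<^sub>R v) = c *\<^sub>R h v)"

(* Tensor fields are families of (multi)linear maps on the tangent spaces, with arbitrary values
   outside them; they are smooth if they send smooth vector fields to smooth objects. *)

definition endo_at :: "('a \<Rightarrow> 'a tangent \<Rightarrow> 'a tangent) \<Rightarrow> 'a vfield \<Rightarrow> 'a vfield" where
  "endo_at \<phi> X = (\<lambda>p. \<phi> p (X p))"

definition form_at :: "('a \<Rightarrow> 'a tangent \<Rightarrow> real) \<Rightarrow> 'a vfield \<Rightarrow> 'a \<Rightarrow> real" where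
  "form_at \<eta> X = (\<lambda>p. \<eta> p (X p))"

definition bilin_at ::
    "('a \<Rightarrow> 'a tangent \<Rightarrow> 'a tangent \<Rightarrow> real) \<Rightarrow> 'a vfield \<Rightarrow> 'a vfield \<Rightarrow> 'a \<Rightarrow> real" where
  "bilin_at g X Y = (\<lambda>p. g p (X p) (Y p))"

definition endo_field ::
    "('a, 'n::finite) chart set \<Rightarrow> ('a \<Rightarrow> 'a tangent \<Rightarrow> 'a tangent) \<Rightarrow> bool" where
  "endo_field A \<phi> \<longleftrightarrow>
     (\<forall>p. lin_on (tangent_space A p) (\<phi> p) \<and> \<phi> p ` tangent_space A p \<subseteq> tangent_space A p) \<and>
     (\<forall>X\<in>vector_fields A. endo_at \<phi> X \<in> vector_fields A)"

definition one_form ::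
    "('a, 'n::finite) chart set \<Rightarrow> ('a \<Rightarrow> 'a tangent \<Rightarrow> real) \<Rightarrow> bool" where
  "one_form A \<eta> \<longleftrightarrow>
     (\<forall>p. lin_on (tangent_space A p) (\<eta> p)) \<and>
     (\<forall>X\<in>vector_fields A. form_at \<eta> X \<in> smooth_functions A)"

definition bilinear_field ::
    "('a, 'n::finite) chart set \<Rightarrow> ('a \<Rightarrow> 'a tangent \<Rightarrow> 'a tangent \<Rightarrow> real) \<Rightarrow> bool" where
  "bilinear_field A g \<longleftrightarrow>
     (\<forall>p. \<forall>v\<in>tangent_space A p.
        lin_on (tangent_space A p) (g p v) \<and> lin_on (tangent_space A p) (\<lambda>w. g p w v)) \<and>
     (\<forall>X\<in>vector_fields A. \<forall>Y\<in>vector_fields A. bilin_at g X Y \<in> smooth_functions A)"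

(* The index of g is constant by continuity, since the manifold is connected. *)

definition pseudo_riemannian ::
    "('a, 'n::finite) chart set \<Rightarrow> ('a \<Rightarrow> 'a tangent \<Rightarrow> 'a tangent \<Rightarrow> real) \<Rightarrow> bool" where
  "pseudo_riemannian A g \<longleftrightarrow> bilinear_field A g \<and>
     (\<forall>p. \<forall>v\<in>tangent_space A p. \<forall>w\<in>tangent_space A p. g p v w = g p w v) \<and>
     (\<forall>p. \<forall>v\<in>tangent_space A p. (\<forall>w\<in>tangent_space A p. g p v w = 0) \<longrightarrow> v = 0)"

definition ext_deriv :: "('a \<Rightarrow> 'a tangent \<Rightarrow> real) \<Rightarrow> 'a vfield \<Rightarrow> 'a vfield \<Rightarrow> 'a \<Rightarrow> real" where
  "ext_deriv \<eta> X Y = (1 / 2) *\<^sub>R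
     (deriv_along X (form_at \<eta> Y) - deriv_along Y (form_at \<eta> X) - form_at \<eta> (lie_bracket X Y))"

definition nijenhuis ::
    "('a \<Rightarrow> 'a tangent \<Rightarrow> 'a tangent) \<Rightarrow> 'a vfield \<Rightarrow> 'a vfield \<Rightarrow> 'a vfield" where
  "nijenhuis \<phi> X Y =
     endo_at \<phi> (endo_at \<phi> (lie_bracket X Y)) + lie_bracket (endo_at \<phi> X) (endo_at \<phi> Y)
     - endo_at \<phi> (lie_bracket (endo_at \<phi> X) Y) - endo_at \<phi> (lie_bracket X (endo_at \<phi> Y))"


section \<open>Connections and Killing fields\<close>

(* A connection is only constrained on smooth vector fields. *)

definition affine_connection ::
    "('a, 'n::finite) chart set \<Rightarrow> ('a vfield \<Rightarrow> 'a vfield \<Rightarrow> 'a vfield) \<Rightarrow> bool" where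
  "affine_connection A nabla \<longleftrightarrow>
     (\<forall>X\<in>vector_fields A. \<forall>Y\<in>vector_fields A. nabla X Y \<in> vector_fields A) \<and>
     (\<forall>X\<in>vector_fields A. \<forall>X'\<in>vector_fields A. \<forall>Y\<in>vector_fields A.
        nabla (X + X') Y = nabla X Y + nabla X' Y) \<and>
     (\<forall>X\<in>vector_fields A. \<forall>Y\<in>vector_fields A. \<forall>Y'\<in>vector_fields A.
        nabla X (Y + Y') = nabla X Y + nabla X Y') \<and>
     (\<forall>f\<in>smooth_functions A. \<forall>X\<in>vector_fields A. \<forall>Y\<in>vector_fields A.
        nabla (fmult f X) Y = fmult f (nabla X Y) \<and>
        nabla X (fmult f Y) = fmult (deriv_along X f) Y + fmult f (nabla X Y))"

definition levi_civita ::
    "('a, 'n::finite) chart set \<Rightarrow> ('a \<Rightarrow> 'a tangent \<Rightarrow> 'a tangent \<Rightarrow> real) \<Rightarrow>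
     ('a vfield \<Rightarrow> 'a vfield \<Rightarrow> 'a vfield) \<Rightarrow> bool" where
  "levi_civita A g nabla \<longleftrightarrow> affine_connection A nabla \<and>
     (\<forall>X\<in>vector_fields A. \<forall>Y\<in>vector_fields A. nabla X Y - nabla Y X = lie_bracket X Y) \<and>
     (\<forall>X\<in>vector_fields A. \<forall>Y\<in>vector_fields A. \<forall>Z\<in>vector_fields A.
        deriv_along X (bilin_at g Y Z) = bilin_at g (nabla X Y) Z + bilin_at g Y (nabla X Z))"

definition lie_deriv_connection ::
    "'a vfield \<Rightarrow> ('a vfield \<Rightarrow> 'a vfield \<Rightarrow> 'a vfield) \<Rightarrow> 'a vfield \<Rightarrow> 'a vfield \<Rightarrow> 'a vfield" where
  "lie_deriv_connection V nabla X Y =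
     lie_bracket V (nabla X Y) - nabla (lie_bracket V X) Y - nabla X (lie_bracket V Y)"

definition lie_deriv_metric ::
    "'a vfield \<Rightarrow> ('a \<Rightarrow> 'a tangent \<Rightarrow> 'a tangent \<Rightarrow> real) \<Rightarrow> 'a vfield \<Rightarrow> 'a vfield \<Rightarrow> 'a \<Rightarrow> real" where
  "lie_deriv_metric V g X Y =
     deriv_along V (bilin_at g X Y) - bilin_at g (lie_bracket V X) Y - bilin_at g X (lie_bracket V Y)"

definition affine_Killing ::
    "('a, 'n::finite) chart set \<Rightarrow> ('a vfield \<Rightarrow> 'a vfield \<Rightarrow> 'a vfield) \<Rightarrow> 'a vfield \<Rightarrow> bool" where
  "affine_Killing A nabla V \<longleftrightarrow> V \<in> vector_fields A \<and>
     (\<forall>X\<in>vector_fields A. \<forall>Y\<in>vector_fields A. lie_deriv_connection V nabla X Y = 0)"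

definition Killing ::
    "('a, 'n::finite) chart set \<Rightarrow> ('a \<Rightarrow> 'a tangent \<Rightarrow> 'a tangent \<Rightarrow> real) \<Rightarrow> 'a vfield \<Rightarrow> bool" where
  "Killing A g V \<longleftrightarrow> V \<in> vector_fields A \<and>
     (\<forall>X\<in>vector_fields A. \<forall>Y\<in>vector_fields A. lie_deriv_metric V g X Y = 0)"


section \<open>Paracontact structures in dimension three\<close>

definition almost_paracontact ::
    "('a::{t2_space, second_countable_topology}, 3) chart set \<Rightarrow> ('a \<Rightarrow> 'a tangent \<Rightarrow> 'a tangent) \<Rightarrow>
     'a vfield \<Rightarrow> ('a \<Rightarrow> 'a tangent \<Rightarrow> real) \<Rightarrow> bool" where
  "almost_paracontact A \<phi> \<xi> \<eta> \<longleftrightarrow> connected_smooth_manifold A \<and>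
     endo_field A \<phi> \<and> \<xi> \<in> vector_fields A \<and> one_form A \<eta> \<and>
     (\<forall>p. \<phi> p (\<xi> p) = 0 \<and> \<eta> p (\<xi> p) = 1 \<and>
        (\<forall>v\<in>tangent_space A p. \<eta> p (\<phi> p v) = 0 \<and> \<phi> p (\<phi> p v) = v - \<eta> p v *\<^sub>R \<xi> p) \<and>
        dim {v \<in> tangent_space A p. \<eta> p v = 0 \<and> \<phi> p v = v} = 1 \<and>
        dim {v \<in> tangent_space A p. \<eta> p v = 0 \<and> \<phi> p v = - v} = 1)"

definition almost_paracontact_metric ::
    "('a::{t2_space, second_countable_topology}, 3) chart set \<Rightarrow> ('a \<Rightarrow> 'a tangent \<Rightarrow> 'a tangent) \<Rightarrow>
     'a vfield \<Rightarrow> ('a \<Rightarrow> 'a tangent \<Rightarrow> real) \<Rightarrow> ('a \<Rightarrow> 'a tangent \<Rightarrow> 'a tangent \<Rightarrow> real) \<Rightarrow> bool" where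
  "almost_paracontact_metric A \<phi> \<xi> \<eta> g \<longleftrightarrow> almost_paracontact A \<phi> \<xi> \<eta> \<and> pseudo_riemannian A g \<and>
     (\<forall>p. \<forall>v\<in>tangent_space A p. \<forall>w\<in>tangent_space A p.
        g p (\<phi> p v) (\<phi> p w) = - g p v w + \<eta> p v * \<eta> p w)"

definition paracontact_metric ::
    "('a::{t2_space, second_countable_topology}, 3) chart set \<Rightarrow> ('a \<Rightarrow> 'a tangent \<Rightarrow> 'a tangent) \<Rightarrow>
     'a vfield \<Rightarrow> ('a \<Rightarrow> 'a tangent \<Rightarrow> real) \<Rightarrow> ('a \<Rightarrow> 'a tangent \<Rightarrow> 'a tangent \<Rightarrow> real) \<Rightarrow> bool" where
  "paracontact_metric A \<phi> \<xi> \<eta> g \<longleftrightarrow> almost_paracontact_metric A \<phi> \<xi> \<eta> g \<and>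
     (\<forall>X\<in>vector_fields A. \<forall>Y\<in>vector_fields A. ext_deriv \<eta> X Y = bilin_at g X (endo_at \<phi> Y))"

definition normal_structure ::
    "('a, 'n::finite) chart set \<Rightarrow> ('a \<Rightarrow> 'a tangent \<Rightarrow> 'a tangent) \<Rightarrow>
     'a vfield \<Rightarrow> ('a \<Rightarrow> 'a tangent \<Rightarrow> real) \<Rightarrow> bool" where
  "normal_structure A \<phi> \<xi> \<eta> \<longleftrightarrow>
     (\<forall>X\<in>vector_fields A. \<forall>Y\<in>vector_fields A.
        nijenhuis \<phi> X Y - fmult (2 *\<^sub>R ext_deriv \<eta> X Y) \<xi> = 0)"

definition paraSasakian ::
    "('a::{t2_space, second_countable_topology}, 3) chart set \<Rightarrow> ('a \<Rightarrow> 'a tangent \<Rightarrow> 'a tangent) \<Rightarrow>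
     'a vfield \<Rightarrow> ('a \<Rightarrow> 'a tangent \<Rightarrow> real) \<Rightarrow> ('a \<Rightarrow> 'a tangent \<Rightarrow> 'a tangent \<Rightarrow> real) \<Rightarrow> bool" where
  "paraSasakian A \<phi> \<xi> \<eta> g \<longleftrightarrow> paracontact_metric A \<phi> \<xi> \<eta> g \<and> normal_structure A \<phi> \<xi> \<eta>"

end

theory Submission
  imports Defs
begin

text \<open>
  Let \<open>T = L\<^sub>\<xi> g\<close>. An affine field preserves the Levi-Civita connection, so \<open>T\<close> is parallel; as
  \<open>T(\<xi>, \<cdot>) = 0\<close>, differentiating gives \<open>T(\<nabla>\<^sub>X \<xi>, \<cdot>) = 0\<close>. Writing \<open>\<nabla>\<^sub>X \<xi> = SX - \<phi>X\<close>, one has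
  \<open>T(X, Y) = 2 g(SX, Y)\<close>, and \<open>L\<^sub>\<xi> d\<eta> = 0\<close> yields \<open>T(\<phi>X, Y) = T(X, \<phi>Y)\<close>. Hence
  \<open>2 g(SX, SY) = T(\<phi>X, Y)\<close>, where replacing \<open>X, Y\<close> by \<open>\<phi>X, \<phi>Y\<close> changes the sign of the
  left-hand side only, so \<open>T = 0\<close>.

  Then \<open>L\<^sub>\<xi> \<phi> = 0\<close>, so the normality tensor vanishes on \<open>\<xi>\<close>. It vanishes on eigenfields of \<open>\<phi>\<close>
  for opposite eigenvalues by a direct computation, and for equal ones because the eigenbundles
  have rank one. No local frames or bump functions are used: if \<open>X, Y\<close> lie in the same line
  bundle then \<open>(Y f) X = (X f) Y\<close> for every smooth \<open>f\<close>, and these global coefficients \<open>Y f\<close>, \<open>X f\<close>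
  detect the points where the fields do not vanish.
\<close>

section \<open>The algebra of smooth functions\<close>

text \<open>On an open set the values of a function determine its derivatives. The inductions below
  use this to replace \<open>frechet_derivative\<close> of a sum or product by the formula of the
  sum or product rule.\<close>

lemma Ck_on_cong:
  assumes "open U" "\<And>x. x \<in> U \<Longrightarrow> f x = h x" "Ck_on k U f"
  shows "Ck_on k U h"
  using assms(2,3)
proof (induction k arbitrary: f h)
  case 0
  then show ?case by (metis Ck_on.simps(1) continuous_on_cong)
next
  case (Suc k)
  have d: "(h has_derivative frechet_derivative f (at x)) (at x)" if "x \<in> U" for x
    using Suc.prems that assms(1)
    by (metis Ck_on.simps(2) frechet_derivative_works has_derivative_transform_within_open)
  then have "frechet_derivative f (at x) = frechet_derivative h (at x)" if "x \<in> U" for x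
    using frechet_derivative_at that by blast
  then have "Ck_on k U (\<lambda>x. frechet_derivative h (at x) v)" for v
    using Suc.IH[of "\<lambda>x. frechet_derivative f (at x) v" "\<lambda>x. frechet_derivative h (at x) v"]
      Suc.prems(2) by simp
  then show ?case
    using d by (auto simp: differentiable_def)
qed

text \<open>The product rule pairs a derivative of class C^k with an undifferentiated factor of
  class C^(k+1); the induction hypothesis needs both at order k.\<close>

lemma Ck_on_lower: "Ck_on (Suc k) U f \<Longrightarrow> Ck_on k U f"
proof (induction k arbitrary: f)
  case 0
  then show ?case
    by (auto intro!: continuous_at_imp_continuous_on differentiable_imp_continuous_within)
qed (metis Ck_on.simps(2))

lemma Ck_on_add:
  assumes "open U" "Ck_on k U f" "Ck_on k U h"
  shows "Ck_on k U (\<lambda>x. f x + h x)"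
  using assms(2,3)
proof (induction k arbitrary: f h)
  case 0
  then show ?case by (simp add: continuous_on_add)
next
  case (Suc k)
  have d: "((\<lambda>x. f x + h x) has_derivative
      (\<lambda>v. frechet_derivative f (at x) v + frechet_derivative h (at x) v)) (at x)"
    if "x \<in> U" for x
    using Suc.prems that by (auto intro!: has_derivative_add simp: frechet_derivative_works[symmetric])
  have "Ck_on k U (\<lambda>x. frechet_derivative (\<lambda>x. f x + h x) (at x) v)" for v
  proof (rule Ck_on_cong[OF assms(1)])
    show "Ck_on k U (\<lambda>x. frechet_derivative f (at x) v + frechet_derivative h (at x) v)"
      using Suc by simp
  qed (simp flip: frechet_derivative_at[OF d])
  then show ?case
    using d by (auto simp: differentiable_def)
qed

lemma Ck_on_mult:
  fixes f h :: "'a::real_normed_vector \<Rightarrow> 'b::real_normed_algebra"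
  assumes "open U" "Ck_on k U f" "Ck_on k U h"
  shows "Ck_on k U (\<lambda>x. f x * h x)"
  using assms(2,3)
proof (induction k arbitrary: f h)
  case 0
  then show ?case by (simp add: continuous_on_mult)
next
  case (Suc k)
  have d: "((\<lambda>x. f x * h x) has_derivative
      (\<lambda>v. f x * frechet_derivative h (at x) v + frechet_derivative f (at x) v * h x)) (at x)"
    if "x \<in> U" for x
    using Suc.prems that by (auto intro!: has_derivative_mult simp: frechet_derivative_works[symmetric])
  have "Ck_on k U (\<lambda>x. frechet_derivative (\<lambda>x. f x * h x) (at x) v)" for v
  proof (rule Ck_on_cong[OF assms(1)])
    show "Ck_on k U (\<lambda>x. f x * frechet_derivative h (at x) v + frechet_derivative f (at x) v * h x)"
      using Suc.prems Ck_on_lower[OF Suc.prems(1)] Ck_on_lower[OF Suc.prems(2)]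
      by (intro Ck_on_add[OF assms(1)] Suc.IH) auto
  qed (simp flip: frechet_derivative_at[OF d])
  then show ?case
    using d by (auto simp: differentiable_def)
qed

lemma Ck_on_const: "Ck_on k U (\<lambda>x. c)"
  by (induction k arbitrary: c) (auto simp: frechet_derivative_const)

lemma smooth_functions_const: "(\<lambda>x. c) \<in> smooth_functions A"
  by (auto simp: smooth_functions_def smooth_on_def o_def Ck_on_const)

section \<open>Vector fields as derivations\<close>

locale smooth_manifold =
  fixes A :: "('a::{t2_space, second_countable_topology}, 'n::finite) chart set"
  assumes atlas: "smooth_atlas A"
begin

abbreviation "SF \<equiv> smooth_functions A"
abbreviation "VF \<equiv> vector_fields A"
abbreviation "TS \<equiv> tangent_space A"

lemma SF_zero [simp]: "0 \<in> SF" and SF_one [simp]: "1 \<in> SF"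
  using smooth_functions_const by (auto simp: zero_fun_def one_fun_def)

lemma SF_add [simp]: "f \<in> SF \<Longrightarrow> h \<in> SF \<Longrightarrow> f + h \<in> SF"
  and SF_mult [simp]: "f \<in> SF \<Longrightarrow> h \<in> SF \<Longrightarrow> f * h \<in> SF"
  using atlas Ck_on_add Ck_on_mult
  by (fastforce simp: smooth_functions_def smooth_on_def o_def smooth_atlas_def)+

lemma SF_scaleR [simp]: "f \<in> SF \<Longrightarrow> c *\<^sub>R f \<in> SF"
  using SF_mult[OF smooth_functions_const[of c]] by (simp add: times_fun_def scaleR_fun_def)

lemma SF_minus [simp]: "f \<in> SF \<Longrightarrow> - f \<in> SF"
  using SF_scaleR[of f "-1"] by simp

lemma SF_diff [simp]: "f \<in> SF \<Longrightarrow> h \<in> SF \<Longrightarrow> f - h \<in> SF"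
  using SF_add[of f "- h"] by simp

lemma tangent_add: "v \<in> TS p \<Longrightarrow> f \<in> SF \<Longrightarrow> h \<in> SF \<Longrightarrow> v (f + h) = v f + v h"
  and tangent_scaleR: "v \<in> TS p \<Longrightarrow> f \<in> SF \<Longrightarrow> v (c *\<^sub>R f) = c * v f"
  and tangent_mult: "v \<in> TS p \<Longrightarrow> f \<in> SF \<Longrightarrow> h \<in> SF \<Longrightarrow> v (f * h) = v f * h p + f p * v h"
  and tangent_outside: "v \<in> TS p \<Longrightarrow> f \<notin> SF \<Longrightarrow> v f = 0"
  by (auto simp: tangent_space_def)

lemma tangent_diff: "v \<in> TS p \<Longrightarrow> f \<in> SF \<Longrightarrow> h \<in> SF \<Longrightarrow> v (f - h) = v f - v h"
  using tangent_add[of v p f "(-1) *\<^sub>R h"] tangent_scaleR[of v p h "-1"] by simp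

lemma tangent_zero: "v \<in> TS p \<Longrightarrow> v 0 = 0"
  using tangent_scaleR[of v p 0 0] by simp

lemma tangent_one: "v \<in> TS p \<Longrightarrow> v 1 = 0"
  using tangent_mult[of v p 1 1] by simp

lemma tangent_eqI: "v \<in> TS p \<Longrightarrow> w \<in> TS p \<Longrightarrow> (\<And>f. f \<in> SF \<Longrightarrow> v f = w f) \<Longrightarrow> v = w"
  by (metis ext tangent_outside)

lemma subspace_tangent: "subspace (TS p)"
  by (auto simp: subspace_def tangent_space_def algebra_simps)

lemma VF_tangent [simp]: "X \<in> VF \<Longrightarrow> X p \<in> TS p"
  and VF_SF [simp]: "X \<in> VF \<Longrightarrow> f \<in> SF \<Longrightarrow> deriv_along X f \<in> SF"
  by (auto simp: vector_fields_def)

lemma VF_eqI: "X \<in> VF \<Longrightarrow> Y \<in> VF \<Longrightarrow> (\<And>p f. f \<in> SF \<Longrightarrow> X p f = Y p f) \<Longrightarrow> X = Y"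
  by (rule ext, rule tangent_eqI[OF VF_tangent VF_tangent]) auto

lemma VF_add [simp]: "X \<in> VF \<Longrightarrow> Y \<in> VF \<Longrightarrow> X + Y \<in> VF"
  using SF_add subspace_add[OF subspace_tangent] unfolding vector_fields_def deriv_along_def plus_fun_def
  by blast

lemma VF_fmult [simp]: "X \<in> VF \<Longrightarrow> a \<in> SF \<Longrightarrow> fmult a X \<in> VF"
  using SF_mult unfolding vector_fields_def
  by (auto simp: subspace_scale[OF subspace_tangent] deriv_along_def fmult_def times_fun_def)

lemma scaleR_eq_fmult: "c *\<^sub>R X = fmult (\<lambda>_. c) X"
  by (auto simp: fmult_def)

lemma VF_scaleR [simp]: "X \<in> VF \<Longrightarrow> c *\<^sub>R X \<in> VF"
  by (simp add: scaleR_eq_fmult smooth_functions_const)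

lemma VF_minus [simp]: "X \<in> VF \<Longrightarrow> - X \<in> VF"
  using VF_scaleR[of X "-1"] by simp

lemma VF_diff [simp]: "X \<in> VF \<Longrightarrow> Y \<in> VF \<Longrightarrow> X - Y \<in> VF"
  using VF_add[of X "- Y"] by simp

lemma deriv_along_add: "X \<in> VF \<Longrightarrow> f \<in> SF \<Longrightarrow> h \<in> SF \<Longrightarrow>
    deriv_along X (f + h) = deriv_along X f + deriv_along X h"
  and deriv_along_diff: "X \<in> VF \<Longrightarrow> f \<in> SF \<Longrightarrow> h \<in> SF \<Longrightarrow>
    deriv_along X (f - h) = deriv_along X f - deriv_along X h"
  and deriv_along_mult: "X \<in> VF \<Longrightarrow> f \<in> SF \<Longrightarrow> h \<in> SF \<Longrightarrow>
    deriv_along X (f * h) = deriv_along X f * h + f * deriv_along X h"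
  and deriv_along_zero [simp]: "X \<in> VF \<Longrightarrow> deriv_along X 0 = 0"
  and deriv_along_one [simp]: "X \<in> VF \<Longrightarrow> deriv_along X 1 = 0"
  by (auto simp: fun_eq_iff deriv_along_def
      tangent_add[OF VF_tangent] tangent_diff[OF VF_tangent] tangent_mult[OF VF_tangent]
      tangent_zero[OF VF_tangent] tangent_one[OF VF_tangent])

lemma deriv_along_outside: "X \<in> VF \<Longrightarrow> f \<notin> SF \<Longrightarrow> deriv_along X f = 0"
  by (auto simp: fun_eq_iff deriv_along_def tangent_outside[OF VF_tangent])

lemma deriv_along_fmult [simp]: "deriv_along (fmult a X) f = a * deriv_along X f"
  and deriv_along_scaleR_field [simp]: "deriv_along (c *\<^sub>R X) f = c *\<^sub>R deriv_along X f"
  and deriv_along_add_field [simp]: "deriv_along (X + Y) f = deriv_along X f + deriv_along Y f"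
  and deriv_along_diff_field [simp]: "deriv_along (X - Y) f = deriv_along X f - deriv_along Y f"
  by (auto simp: fun_eq_iff deriv_along_def fmult_def)

lemma deriv_along_bracket: "deriv_along (lie_bracket X Y) f =
    deriv_along X (deriv_along Y f) - deriv_along Y (deriv_along X f)"
  by (auto simp: fun_eq_iff deriv_along_def lie_bracket_def)

text \<open>Rephrases the pointwise derivation axioms as identities between global operators on
  functions, so that the bracket can be treated as a commutator.\<close>

lemma VF_I:
  assumes "\<And>f. f \<in> SF \<Longrightarrow> deriv_along X f \<in> SF"
    and "\<And>f h. f \<in> SF \<Longrightarrow> h \<in> SF \<Longrightarrow> deriv_along X (f + h) = deriv_along X f + deriv_along X h"
    and "\<And>f c. f \<in> SF \<Longrightarrow> deriv_along X (c *\<^sub>R f) = c *\<^sub>R deriv_along X f"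
    and "\<And>f h. f \<in> SF \<Longrightarrow> h \<in> SF \<Longrightarrow>
      deriv_along X (f * h) = deriv_along X f * h + f * deriv_along X h"
    and "\<And>f. f \<notin> SF \<Longrightarrow> deriv_along X f = 0"
  shows "X \<in> VF"
  using assms by (auto simp: vector_fields_def tangent_space_def deriv_along_def fun_eq_iff)

lemma deriv_along_scaleR: "X \<in> VF \<Longrightarrow> f \<in> SF \<Longrightarrow> deriv_along X (c *\<^sub>R f) = c *\<^sub>R deriv_along X f"
  by (auto simp: fun_eq_iff deriv_along_def tangent_scaleR[OF VF_tangent])

lemma VF_bracket [simp]:
  assumes "X \<in> VF" "Y \<in> VF"
  shows "lie_bracket X Y \<in> VF"
  by (rule VF_I)
    (use assms in \<open>simp_all add: deriv_along_bracket deriv_along_add deriv_along_mult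
      deriv_along_scaleR deriv_along_outside algebra_simps\<close>)

lemma VF_zero [simp]: "0 \<in> VF"
  using VF_I[of 0] by (simp add: deriv_along_def flip: zero_fun_def)

text \<open>Tangent vectors vanish off the smooth functions, so smooth f suffice as tests; bracket
  identities, Jacobi included, become ring identities between iterated derivatives.\<close>

lemma VF_eqI_deriv: "X \<in> VF \<Longrightarrow> Y \<in> VF \<Longrightarrow>
    (\<And>f. f \<in> SF \<Longrightarrow> deriv_along X f = deriv_along Y f) \<Longrightarrow> X = Y"
  by (rule VF_eqI) (auto simp: deriv_along_def fun_eq_iff)

lemma bracket_anti: "lie_bracket X Y = - lie_bracket Y X"
  and bracket_self [simp]: "lie_bracket X X = 0"
  by (auto simp: fun_eq_iff lie_bracket_def)

lemma bracket_add_right: "X \<in> VF \<Longrightarrow> Y \<in> VF \<Longrightarrow> Z \<in> VF \<Longrightarrow>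
    lie_bracket X (Y + Z) = lie_bracket X Y + lie_bracket X Z"
  and bracket_add_left: "X \<in> VF \<Longrightarrow> Y \<in> VF \<Longrightarrow> Z \<in> VF \<Longrightarrow>
    lie_bracket (X + Y) Z = lie_bracket X Z + lie_bracket Y Z"
  and bracket_diff_right: "X \<in> VF \<Longrightarrow> Y \<in> VF \<Longrightarrow> Z \<in> VF \<Longrightarrow>
    lie_bracket X (Y - Z) = lie_bracket X Y - lie_bracket X Z"
  and bracket_fmult_right: "X \<in> VF \<Longrightarrow> Y \<in> VF \<Longrightarrow> a \<in> SF \<Longrightarrow>
    lie_bracket X (fmult a Y) = fmult a (lie_bracket X Y) + fmult (deriv_along X a) Y"
  and bracket_fmult_left: "X \<in> VF \<Longrightarrow> Y \<in> VF \<Longrightarrow> a \<in> SF \<Longrightarrow>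
    lie_bracket (fmult a X) Y = fmult a (lie_bracket X Y) - fmult (deriv_along Y a) X"
  and jacobi: "X \<in> VF \<Longrightarrow> Y \<in> VF \<Longrightarrow> Z \<in> VF \<Longrightarrow>
    lie_bracket X (lie_bracket Y Z) =
      lie_bracket (lie_bracket X Y) Z + lie_bracket Y (lie_bracket X Z)"
  by (rule VF_eqI_deriv; simp add: deriv_along_bracket deriv_along_add deriv_along_diff
      deriv_along_mult algebra_simps)+

lemma bracket_scaleR_right: "X \<in> VF \<Longrightarrow> Y \<in> VF \<Longrightarrow>
    lie_bracket X (c *\<^sub>R Y) = c *\<^sub>R lie_bracket X Y"
  and bracket_scaleR_left: "X \<in> VF \<Longrightarrow> Y \<in> VF \<Longrightarrow>
    lie_bracket (c *\<^sub>R Y) X = c *\<^sub>R lie_bracket Y X"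
  by (rule VF_eqI_deriv; simp add: deriv_along_bracket deriv_along_scaleR
      algebra_simps)+

lemma bracket_zero [simp]: "X \<in> VF \<Longrightarrow> lie_bracket X 0 = 0" "X \<in> VF \<Longrightarrow> lie_bracket 0 X = 0"
  using bracket_scaleR_right[of X X 0] bracket_scaleR_left[of X X 0] by simp_all

lemma bracket_minus_right: "X \<in> VF \<Longrightarrow> Y \<in> VF \<Longrightarrow> lie_bracket X (- Y) = - lie_bracket X Y"
  and bracket_minus_left: "X \<in> VF \<Longrightarrow> Y \<in> VF \<Longrightarrow> lie_bracket (- X) Y = - lie_bracket X Y"
  using bracket_scaleR_right[of X Y "-1"] bracket_scaleR_left[of Y X "-1"] by simp_all

end

section \<open>The Lie derivative of the metric along the Reeb field\<close>

lemma lin_onD: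
  assumes "lin_on S h" "subspace S"
  shows "v \<in> S \<Longrightarrow> w \<in> S \<Longrightarrow> h (v + w) = h v + h w"
    and "v \<in> S \<Longrightarrow> h (c *\<^sub>R v) = c *\<^sub>R h v"
    and "v \<in> S \<Longrightarrow> h (- v) = - h v"
    and "v \<in> S \<Longrightarrow> w \<in> S \<Longrightarrow> h (v - w) = h v - h w"
    and "h 0 = 0"
proof -
  show add: "h (v + w) = h v + h w" if "v \<in> S" "w \<in> S" for v w
    using that assms by (auto simp: lin_on_def)
  show scale: "h (c *\<^sub>R v) = c *\<^sub>R h v" if "v \<in> S" for c v
    using that assms by (auto simp: lin_on_def)
  show neg: "h (- v) = - h v" if "v \<in> S" for v
    using scale[OF that, of "-1"] by simp
  show "h (v - w) = h v - h w" if "v \<in> S" "w \<in> S" for v w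
    using that add[of v "- w"] neg[of w] subspace_neg[OF assms(2)] by simp
  show "h 0 = 0"
    using scale[of 0 0] subspace_0[OF assms(2)] by simp
qed

section \<open>Tensor algebra of a paracontact metric structure\<close>

locale paracontact_manifold =
  fixes A :: "('a::{t2_space, second_countable_topology}, 3) chart set"
    and \<phi> :: "'a \<Rightarrow> 'a tangent \<Rightarrow> 'a tangent"
    and \<xi> :: "'a vfield"
    and \<eta> :: "'a \<Rightarrow> 'a tangent \<Rightarrow> real"
    and g :: "'a \<Rightarrow> 'a tangent \<Rightarrow> 'a tangent \<Rightarrow> real"
  assumes paracontact_metric: "paracontact_metric A \<phi> \<xi> \<eta> g"
begin

lemma almost_paracontact_metric: "almost_paracontact_metric A \<phi> \<xi> \<eta> g"
  and almost_paracontact: "almost_paracontact A \<phi> \<xi> \<eta>"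
  and metric: "pseudo_riemannian A g"
  using paracontact_metric by (auto simp: paracontact_metric_def almost_paracontact_metric_def)

sublocale smooth_manifold A
  using almost_paracontact by unfold_locales (simp add: almost_paracontact_def connected_smooth_manifold_def)

abbreviation "P \<equiv> endo_at \<phi>"
abbreviation "e \<equiv> form_at \<eta>"
abbreviation "G \<equiv> bilin_at g"
abbreviation "B \<equiv> lie_bracket"
abbreviation "D \<equiv> deriv_along"

lemma \<xi>_VF [simp]: "\<xi> \<in> VF"
  and P_VF [simp]: "X \<in> VF \<Longrightarrow> P X \<in> VF"
  and e_SF [simp]: "X \<in> VF \<Longrightarrow> e X \<in> SF"
  and G_SF [simp]: "X \<in> VF \<Longrightarrow> Y \<in> VF \<Longrightarrow> G X Y \<in> SF"
  and \<phi>_lin: "lin_on (TS p) (\<phi> p)"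
  and \<phi>_TS [simp]: "v \<in> TS p \<Longrightarrow> \<phi> p v \<in> TS p"
  and \<eta>_lin: "lin_on (TS p) (\<eta> p)"
  and g_lin_right: "v \<in> TS p \<Longrightarrow> lin_on (TS p) (g p v)"
  and g_lin_left: "w \<in> TS p \<Longrightarrow> lin_on (TS p) (\<lambda>v. g p v w)"
  using almost_paracontact metric
  by (auto simp: almost_paracontact_def endo_field_def one_form_def pseudo_riemannian_def
      bilinear_field_def image_subset_iff)

lemmas \<phi>_simps [simp] = lin_onD[OF \<phi>_lin subspace_tangent]
lemmas \<eta>_simps [simp] = lin_onD[OF \<eta>_lin subspace_tangent]
lemmas g_right_simps [simp] = lin_onD[OF g_lin_right subspace_tangent]
lemmas g_left_simps [simp] = lin_onD[OF g_lin_left subspace_tangent]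
lemmas TS_closed [simp] = subspace_add[OF subspace_tangent] subspace_diff[OF subspace_tangent]
  subspace_scale[OF subspace_tangent] subspace_neg[OF subspace_tangent] subspace_0[OF subspace_tangent]

lemma \<phi>_\<xi> [simp]: "\<phi> p (\<xi> p) = 0"
  and \<eta>_\<xi> [simp]: "\<eta> p (\<xi> p) = 1"
  and \<eta>_\<phi> [simp]: "v \<in> TS p \<Longrightarrow> \<eta> p (\<phi> p v) = 0"
  and \<phi>_\<phi>: "v \<in> TS p \<Longrightarrow> \<phi> p (\<phi> p v) = v - \<eta> p v *\<^sub>R \<xi> p"
  and g_sym: "v \<in> TS p \<Longrightarrow> w \<in> TS p \<Longrightarrow> g p v w = g p w v"
  and g_nondegenerate: "v \<in> TS p \<Longrightarrow> (\<And>w. w \<in> TS p \<Longrightarrow> g p v w = 0) \<Longrightarrow> v = 0"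
  and g_compat: "v \<in> TS p \<Longrightarrow> w \<in> TS p \<Longrightarrow> g p (\<phi> p v) (\<phi> p w) = - g p v w + \<eta> p v * \<eta> p w"
  using almost_paracontact metric almost_paracontact_metric
  by (auto simp: almost_paracontact_def almost_paracontact_metric_def pseudo_riemannian_def)

text \<open>Compatibility at \<xi>, where the left-hand side vanishes because \<phi>\<xi> =
  0.\<close>

lemma g_\<xi> [simp]: "w \<in> TS p \<Longrightarrow> g p (\<xi> p) w = \<eta> p w"
  using g_compat[of "\<xi> p" p w] by simp

text \<open>Compatibility for v and \<phi>w, where the \<xi>-part of \<phi>(\<phi>w) drops out since
  g(\<phi>v, \<xi>) = \<eta>(\<phi>v) = 0.\<close>

lemma g_\<phi>: "v \<in> TS p \<Longrightarrow> w \<in> TS p \<Longrightarrow> g p (\<phi> p v) w = - g p v (\<phi> p w)"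
  using g_compat[of v p "\<phi> p w"] g_sym[of "\<phi> p v" p "\<xi> p"] by (simp add: \<phi>_\<phi>)

text \<open>This is where the rank-one condition on the eigenbundles enters.\<close>

lemma eigenline:
  assumes "c = 1 \<or> c = - 1"
  obtains u where "\<And>v. v \<in> TS p \<Longrightarrow> \<phi> p v = c *\<^sub>R v \<Longrightarrow> \<exists>t. v = t *\<^sub>R u"
proof -
  define S where "S = {v \<in> TS p. \<eta> p v = 0 \<and> \<phi> p v = c *\<^sub>R v}"
  have "dim S = 1"
    using assms almost_paracontact by (auto simp: almost_paracontact_def S_def)
  then obtain b where "S \<subseteq> span b" "card b = 1"
    by (metis basis_exists)
  then obtain u where u: "S \<subseteq> span {u}"
    by (auto simp: card_1_singleton_iff)
  \<comment> \<open>Eigenvectors lie in the kernel of \<eta> automatically: c \<eta>(v) =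
    \<eta>(\<phi>v) = 0.\<close>
  have "v \<in> S" if "v \<in> TS p" "\<phi> p v = c *\<^sub>R v" for v
    using that \<eta>_\<phi>[of v p] assms by (auto simp: S_def)
  then show thesis
    using u by (intro that[of u]) (auto simp: span_singleton)
qed

lemma P_add: "X \<in> VF \<Longrightarrow> Y \<in> VF \<Longrightarrow> P (X + Y) = P X + P Y"
  and P_diff: "X \<in> VF \<Longrightarrow> Y \<in> VF \<Longrightarrow> P (X - Y) = P X - P Y"
  and P_minus: "X \<in> VF \<Longrightarrow> P (- X) = - P X"
  and P_scaleR: "X \<in> VF \<Longrightarrow> P (c *\<^sub>R X) = c *\<^sub>R P X"
  and P_fmult: "X \<in> VF \<Longrightarrow> P (fmult a X) = fmult a (P X)"
  and P_\<xi> [simp]: "P \<xi> = 0"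
  and P_zero [simp]: "P 0 = 0"
  and P_P: "X \<in> VF \<Longrightarrow> P (P X) = X - fmult (e X) \<xi>"
  by (rule ext; simp add: endo_at_def fmult_def form_at_def \<phi>_\<phi> zero_fun_def[where ?'b = "'a tangent"])+

lemma e_add: "X \<in> VF \<Longrightarrow> Y \<in> VF \<Longrightarrow> e (X + Y) = e X + e Y"
  and e_diff: "X \<in> VF \<Longrightarrow> Y \<in> VF \<Longrightarrow> e (X - Y) = e X - e Y"
  and e_scaleR: "X \<in> VF \<Longrightarrow> e (c *\<^sub>R X) = c *\<^sub>R e X"
  and e_\<xi> [simp]: "e \<xi> = 1"
  and e_P [simp]: "X \<in> VF \<Longrightarrow> e (P X) = 0"
  by (rule ext; simp add: endo_at_def fmult_def form_at_def)+

lemma G_add_left: "X \<in> VF \<Longrightarrow> Y \<in> VF \<Longrightarrow> Z \<in> VF \<Longrightarrow> G (X + Y) Z = G X Z + G Y Z"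
  and G_diff_left: "X \<in> VF \<Longrightarrow> Y \<in> VF \<Longrightarrow> Z \<in> VF \<Longrightarrow> G (X - Y) Z = G X Z - G Y Z"
  and G_add_right: "X \<in> VF \<Longrightarrow> Y \<in> VF \<Longrightarrow> Z \<in> VF \<Longrightarrow> G X (Y + Z) = G X Y + G X Z"
  and G_diff_right: "X \<in> VF \<Longrightarrow> Y \<in> VF \<Longrightarrow> Z \<in> VF \<Longrightarrow> G X (Y - Z) = G X Y - G X Z"
  and G_minus_right: "X \<in> VF \<Longrightarrow> Y \<in> VF \<Longrightarrow> G X (- Y) = - G X Y"
  and G_fmult_left: "X \<in> VF \<Longrightarrow> Y \<in> VF \<Longrightarrow> G (fmult a X) Y = a * G X Y"
  and G_fmult_right: "X \<in> VF \<Longrightarrow> Y \<in> VF \<Longrightarrow> G X (fmult a Y) = a * G X Y"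
  and G_zero: "X \<in> VF \<Longrightarrow> G X 0 = 0" "X \<in> VF \<Longrightarrow> G 0 X = 0"
  and G_sym: "X \<in> VF \<Longrightarrow> Y \<in> VF \<Longrightarrow> G X Y = G Y X"
  by (rule ext; simp add: fmult_def bilin_at_def g_sym)+

lemma G_\<xi>_left [simp]: "X \<in> VF \<Longrightarrow> G \<xi> X = e X"
  and G_P: "X \<in> VF \<Longrightarrow> Y \<in> VF \<Longrightarrow> G (P X) Y = - G X (P Y)"
  by (rule ext; simp add: endo_at_def form_at_def bilin_at_def g_\<phi>)+

lemma G_\<xi>_right [simp]: "X \<in> VF \<Longrightarrow> G X \<xi> = e X"
  by (simp add: G_sym[of X \<xi>])

lemma fmult_zero [simp]: "fmult 0 X = 0" "fmult a 0 = 0" and fmult_one [simp]: "fmult 1 X = X"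
  by (auto simp: fmult_def fun_eq_iff)

lemma fmult_minus: "fmult a (- X) = - fmult a X"
  by (auto simp: fmult_def fun_eq_iff)

section \<open>The contact condition and Lie derivatives along the Reeb field\<close>

lemma contact:
  assumes "X \<in> VF" "Y \<in> VF"
  shows "D X (e Y) p - D Y (e X) p - e (B X Y) p = 2 * G X (P Y) p"
proof -
  have "ext_deriv \<eta> X Y p = G X (P Y) p"
    using paracontact_metric assms by (simp add: paracontact_metric_def)
  then show ?thesis
    by (simp add: ext_deriv_def field_simps)
qed

text \<open>This is L_\<xi> \<eta> = 0: in the contact condition for \<xi> and X, both
  \<eta>(\<phi>X) and X(\<eta>(\<xi>)) vanish.\<close>

lemma e_bracket_\<xi>:
  assumes "X \<in> VF"
  shows "e (B \<xi> X) = D \<xi> (e X)"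
proof
  fix p show "e (B \<xi> X) p = D \<xi> (e X) p"
    using contact[of \<xi> X p] assms by simp
qed

text \<open>This is L_\<xi> d\<eta> = d L_\<xi> \<eta> = 0, read through d\<eta> = g(.,
  \<phi>.).\<close>

lemma lie_deriv_contact_form:
  assumes "X \<in> VF" "Y \<in> VF"
  shows "D \<xi> (G X (P Y)) = G (B \<xi> X) (P Y) + G X (P (B \<xi> Y))"
proof
  fix p
  \<comment> \<open>\<open>w\<close> is 2 d\<eta>. Its invariance follows from L_\<xi> \<eta> = 0 in
    each term, with Jacobi for the bracket term.\<close>
  define w where "w X Y = D X (e Y) - D Y (e X) - e (B X Y)" for X Y
  have w: "w X Y = 2 *\<^sub>R G X (P Y)" if "X \<in> VF" "Y \<in> VF" for X Y
    using contact[OF that] by (auto simp: w_def fun_eq_iff)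
  have "D \<xi> (w X Y) p = w (B \<xi> X) Y p + w X (B \<xi> Y) p"
    using assms e_bracket_\<xi>[of "B X Y", THEN fun_cong, of p]
    by (simp add: w_def deriv_along_bracket deriv_along_diff e_bracket_\<xi> jacobi[of \<xi> X Y] e_add)
  then show "D \<xi> (G X (P Y)) p = (G (B \<xi> X) (P Y) + G X (P (B \<xi> Y))) p"
    using assms by (simp add: w deriv_along_scaleR)
qed

text \<open>\<open>H = L\<^sub>\<xi> \<phi>\<close>, twice the tensor \<open>h\<close> of paracontact geometry.\<close>

definition H :: "'a vfield \<Rightarrow> 'a vfield" where
  "H Y = B \<xi> (P Y) - P (B \<xi> Y)"

abbreviation "T \<equiv> lie_deriv_metric \<xi> g"

lemma H_VF [simp]: "Y \<in> VF \<Longrightarrow> H Y \<in> VF"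
  by (simp add: H_def)

text \<open>The Lie derivative of \<phi>^2 = Id - \<eta> \<otimes> \<xi> along \<xi> is zero, so
  \<phi> anticommutes with its own Lie derivative.\<close>

lemma H_P:
  assumes "Y \<in> VF"
  shows "H (P Y) = - P (H Y)"
proof -
  have "B \<xi> (P (P Y)) = P (P (B \<xi> Y))"
    using assms by (simp add: P_P bracket_diff_right bracket_fmult_right e_bracket_\<xi>)
  then show ?thesis
    using assms by (simp add: H_def P_diff)
qed

lemma e_H: "Y \<in> VF \<Longrightarrow> e (H Y) = 0"
  by (simp add: H_def e_diff e_bracket_\<xi>)

text \<open>The invariance of g(., \<phi>.) under \<xi>, expanded by the Leibniz rule in g and
  \<phi>.\<close>

lemma T_P: "X \<in> VF \<Longrightarrow> Y \<in> VF \<Longrightarrow> T X (P Y) = - G X (H Y)"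
  by (simp add: lie_deriv_metric_def lie_deriv_contact_form H_def G_diff_right)

lemma T_sym: "X \<in> VF \<Longrightarrow> Y \<in> VF \<Longrightarrow> T X Y = T Y X"
  by (simp add: lie_deriv_metric_def G_sym algebra_simps)

lemma T_\<xi>_right [simp]: "X \<in> VF \<Longrightarrow> T X \<xi> = 0"
  and T_\<xi>_left [simp]: "X \<in> VF \<Longrightarrow> T \<xi> X = 0"
  by (simp_all add: lie_deriv_metric_def e_bracket_\<xi> G_zero)

lemma T_diff_right: "X \<in> VF \<Longrightarrow> Y \<in> VF \<Longrightarrow> Z \<in> VF \<Longrightarrow> T X (Y - Z) = T X Y - T X Z"
  and T_add_right: "X \<in> VF \<Longrightarrow> Y \<in> VF \<Longrightarrow> Z \<in> VF \<Longrightarrow> T X (Y + Z) = T X Y + T X Z"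
  and T_fmult_right: "X \<in> VF \<Longrightarrow> Y \<in> VF \<Longrightarrow> a \<in> SF \<Longrightarrow> T X (fmult a Y) = a * T X Y"
  by (simp_all add: lie_deriv_metric_def G_diff_right G_add_right G_fmult_right deriv_along_diff
      deriv_along_add deriv_along_mult bracket_diff_right bracket_add_right bracket_fmult_right
      algebra_simps)

lemma T_P_P: "X \<in> VF \<Longrightarrow> Y \<in> VF \<Longrightarrow> T X (P (P Y)) = T X Y"
  by (simp add: P_P T_diff_right T_fmult_right)

lemma T_P_shift:
  assumes "X \<in> VF" "Y \<in> VF"
  shows "T (P X) Y = T X (P Y)"
proof -
  \<comment> \<open>Invariance of T under \<phi>, since \<phi> anticommutes with \<open>H\<close>
    and is skew for g. Applied to \<phi>X and Y it gives the claim.\<close>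
  have *: "T X Y = T (P X) (P Y)" if "X \<in> VF" "Y \<in> VF" for X Y
  proof -
    have "T X Y = - G X (H (P Y))"
      using that T_P[of X "P Y"] by (simp add: T_P_P)
    also have "\<dots> = T (P X) (P Y)"
      using that by (simp add: H_P G_minus_right T_P G_P)
    finally show ?thesis .
  qed
  show ?thesis
    using assms *[of "P X" Y] T_P_P[of X "P Y"] T_sym[of "P (P X)" "P Y"] T_sym[of X "P Y"]
      T_P_P[of "P Y" X] by simp
qed

lemma affine_Killing_imp_Killing:
  assumes "levi_civita A g nabla" "affine_Killing A nabla \<xi>"
  shows "Killing A g \<xi>"
proof -
  have VF_nabla [simp]: "nabla X Y \<in> VF" if "X \<in> VF" "Y \<in> VF" for X Y
    using assms that by (simp add: levi_civita_def affine_connection_def)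
  have torsion_free: "B X Y = nabla X Y - nabla Y X" if "X \<in> VF" "Y \<in> VF" for X Y
    using assms that by (simp add: levi_civita_def)
  have compat: "D X (G Y Z) = G (nabla X Y) Z + G Y (nabla X Z)"
    if "X \<in> VF" "Y \<in> VF" "Z \<in> VF" for X Y Z
    using assms that by (simp add: levi_civita_def)
  have affine: "B \<xi> (nabla X Y) = nabla (B \<xi> X) Y + nabla X (B \<xi> Y)" if "X \<in> VF" "Y \<in> VF" for X Y
    using assms that by (simp add: affine_Killing_def lie_deriv_connection_def algebra_simps)
  \<comment> \<open>The flow of \<xi> preserves the connection, so L_\<xi> g inherits parallelism
    from g.\<close>
  have parallel: "D X (T Y Z) = T (nabla X Y) Z + T Y (nabla X Z)"
    if [simp]: "X \<in> VF" "Y \<in> VF" "Z \<in> VF" for X Y Z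
  proof -
    have "D \<xi> (D X (G Y Z)) - D X (D \<xi> (G Y Z)) = D (B \<xi> X) (G Y Z)"
      by (simp add: deriv_along_bracket)
    then show ?thesis
      by (simp add: lie_deriv_metric_def deriv_along_diff deriv_along_add compat affine G_add_left
          G_add_right algebra_simps)
  qed
  \<comment> \<open>The g-symmetric part of \<nabla>\<xi>: symmetrizing g(\<nabla>\<xi>, .) gives T,
    and antisymmetrizing gives 2 d\<eta>, which accounts for -\<phi>.\<close>
  define S where "S X = nabla X \<xi> + P X" for X
  have S_VF [simp]: "S X \<in> VF" if "X \<in> VF" for X
    using that by (simp add: S_def)
  have T_S: "T X Y p = 2 * G (S X) Y p" if [simp]: "X \<in> VF" "Y \<in> VF" for X Y p
  proof -
    have "T X Y p = G (nabla X \<xi>) Y p + G (nabla Y \<xi>) X p"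
      by (simp add: lie_deriv_metric_def compat torsion_free G_diff_left G_diff_right
          G_sym[of X "nabla Y \<xi>"])
    moreover have "2 * G X (P Y) p = G (nabla X \<xi>) Y p - G (nabla Y \<xi>) X p"
      using contact[of X Y p] compat[of X \<xi> Y] compat[of Y \<xi> X]
      by (simp add: torsion_free e_diff)
    ultimately show ?thesis
      by (simp add: S_def G_add_left G_P)
  qed
  \<comment> \<open>Differentiating T(\<xi>, Y) = 0 along X leaves T(\<nabla>_X \<xi>, Y) = 0, and
    SX exceeds \<nabla>_X \<xi> by \<phi>X.\<close>
  have T_S_left: "T (S X) Y = T (P X) Y" if [simp]: "X \<in> VF" "Y \<in> VF" for X Y
    using parallel[of X \<xi> Y] by (simp add: S_def T_add_right T_sym[of _ Y])
  \<comment> \<open>The quantity 2 g(SX, \<phi>S\<phi>Y) is evaluated twice. Absorbing the first S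
    into T gives T(X, \<phi>Y); moving \<phi> across g and absorbing the other S gives -T(X,
    \<phi>Y).\<close>
  have "T X (P Y) p = 0" if [simp]: "X \<in> VF" "Y \<in> VF" for X Y p
  proof -
    have "T (P X) (S (P Y)) = T (P X) (P (P Y))"
      using T_S_left[of "P Y" "P X"] by (simp add: T_sym[of "P X"])
    also have "\<dots> = T X (P Y)"
      by (simp add: T_P_P T_P_shift)
    finally have "T X (P Y) p = T X (P (S (P Y))) p"
      by (simp add: T_P_shift)
    also have "\<dots> = 2 * G (S X) (P (S (P Y))) p"
      by (simp add: T_S)
    also have "\<dots> = - (2 * G (S (P Y)) (P (S X)) p)"
      using G_P[of "S X" "S (P Y)"] G_sym[of "P (S X)" "S (P Y)"] by simp
    also have "\<dots> = - T (P Y) (P (S X)) p"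
      by (simp add: T_S)
    also have "T (P Y) (P (S X)) = T (S X) (P (P Y))"
      by (simp add: T_P_shift[of "S X", symmetric] T_sym[of "P Y"])
    also have "\<dots> = T X (P Y)"
      by (simp add: T_P_P T_S_left T_P_shift)
    finally show ?thesis
      by simp
  qed
  then have "T X Y = 0" if "X \<in> VF" "Y \<in> VF" for X Y
    using that T_P_P[of X Y] by (simp add: fun_eq_iff)
  then show ?thesis
    by (simp add: Killing_def)
qed

section \<open>Killing Reeb fields and normality\<close>

text \<open>If X = a u and Y = b u at a point, both sides are a b u(f) u there.\<close>

lemma eigenfields_proportional:
  assumes "c = 1 \<or> c = - 1" "X \<in> VF" "Y \<in> VF" "P X = c *\<^sub>R X" "P Y = c *\<^sub>R Y"
  shows "fmult (D Y f) X = fmult (D X f) Y"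
proof
  fix p
  obtain u where u: "\<And>v. v \<in> TS p \<Longrightarrow> \<phi> p v = c *\<^sub>R v \<Longrightarrow> \<exists>t. v = t *\<^sub>R u"
    using eigenline[OF assms(1)] by blast
  obtain a b where "X p = a *\<^sub>R u" "Y p = b *\<^sub>R u"
    using u[of "X p"] u[of "Y p"] assms(2-5) by (auto simp: endo_at_def fun_eq_iff)
  then show "fmult (D Y f) X p = fmult (D X f) Y p"
    by (simp add: fmult_def deriv_along_def algebra_simps)
qed

section \<open>The Lie derivative of \<phi> on eigenfields\<close>

lemma H_scaleR: "Y \<in> VF \<Longrightarrow> H (c *\<^sub>R Y) = c *\<^sub>R H Y"
  by (simp add: H_def P_scaleR bracket_scaleR_right scaleR_right_diff_distrib)

lemma H_add: "X \<in> VF \<Longrightarrow> Y \<in> VF \<Longrightarrow> H (X + Y) = H X + H Y"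
  by (simp add: H_def P_add bracket_add_right)

text \<open>Both brackets in \<open>H\<close> contribute (\<xi> a) \<phi>Y, and these terms
  cancel.\<close>

lemma H_fmult: "Y \<in> VF \<Longrightarrow> a \<in> SF \<Longrightarrow> H (fmult a Y) = fmult a (H Y)"
  by (rule ext) (simp add: H_def P_fmult P_add bracket_fmult_right, simp add: fmult_def scaleR_right_diff_distrib)

text \<open>For c = 1 or c = -1, \<open>Q c\<close> is the projection of X to the c-eigenbundle;
  this rests on \<phi>^3 = \<phi>.\<close>

lemma eigen_decomposition:
  fixes X
  assumes "X \<in> VF"
  defines "Q c \<equiv> (1 / 2) *\<^sub>R (P (P X) + c *\<^sub>R P X)"
  shows "X = fmult (e X) \<xi> + Q 1 + Q (- 1)"
    and "Q c \<in> VF"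
    and "c = 1 \<or> c = - 1 \<Longrightarrow> P (Q c) = c *\<^sub>R Q c"
proof -
  have "(1 / 2 :: real) *\<^sub>R Y + (1 / 2 :: real) *\<^sub>R Y = Y" for Y :: "'a vfield"
    by (simp flip: scaleR_left_distrib)
  then show "X = fmult (e X) \<xi> + Q 1 + Q (- 1)"
    using assms by (simp add: Q_def P_P algebra_simps)
  show "Q c \<in> VF"
    using assms by (simp add: Q_def)
  have "P (P (P X)) = P X"
    using assms P_P[of "P X"] by simp
  then show "P (Q c) = c *\<^sub>R Q c" if "c = 1 \<or> c = - 1"
    using assms that by (auto simp: Q_def P_scaleR P_add P_minus algebra_simps)
qed

text \<open>By anticommutation HY lies in the (-c)-eigenspace, so it is orthogonal to that
  eigenspace and to \<xi>. The c-eigenspace is spanned by the nonzero vector Y p, to which HY is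
  orthogonal by hypothesis; nondegeneracy finishes.\<close>

lemma H_eigenfield_zero_at:
  assumes c: "c = 1 \<or> c = - 1" and [simp]: "Y \<in> VF" and PY: "P Y = c *\<^sub>R Y"
    and "G Y (H Y) p = 0" and "Y p \<noteq> 0"
  shows "H Y p = 0"
proof (rule g_nondegenerate)
  show "H Y p \<in> TS p" by simp
  have "c *\<^sub>R H Y = - P (H Y)"
    using H_P[of Y] by (simp add: PY H_scaleR)
  then have \<phi>H: "\<phi> p (H Y p) = - c *\<^sub>R H Y p"
    by (simp add: fun_eq_iff endo_at_def)
  have \<eta>H: "\<eta> p (H Y p) = 0"
    using e_H[of Y] by (simp add: form_at_def fun_eq_iff)
  obtain u where u: "\<And>v. v \<in> TS p \<Longrightarrow> \<phi> p v = c *\<^sub>R v \<Longrightarrow> \<exists>t. v = t *\<^sub>R u"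
    using eigenline[OF c] by blast
  have \<phi>Y: "\<phi> p (Y p) = c *\<^sub>R Y p"
    using PY by (simp add: fun_eq_iff endo_at_def)
  then obtain a where a: "Y p = a *\<^sub>R u"
    using u[of "Y p"] by auto
  with \<open>Y p \<noteq> 0\<close> have "a \<noteq> 0" by auto
  fix w assume w [simp]: "w \<in> TS p"
  \<comment> \<open>The tested vector is a (-c)-eigenvector, like HY; skewness of \<phi> makes two
    such vectors orthogonal.\<close>
  have same: "g p (H Y p) (c *\<^sub>R \<phi> p (\<phi> p w) - \<phi> p w) = 0"
  proof -
    have "g p (H Y p) (\<phi> p (\<phi> p w)) = c * g p (H Y p) (\<phi> p w)"
      using g_\<phi>[of "H Y p" p "\<phi> p w"] \<phi>H c by (auto simp: algebra_simps)
    with c show ?thesis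
      by (auto simp: algebra_simps)
  qed
  have "\<phi> p (c *\<^sub>R \<phi> p (\<phi> p w) + \<phi> p w) = c *\<^sub>R (c *\<^sub>R \<phi> p (\<phi> p w) + \<phi> p w)"
    using c \<phi>_\<phi>[of "\<phi> p w" p] by (auto simp: algebra_simps)
  then obtain b where "c *\<^sub>R \<phi> p (\<phi> p w) + \<phi> p w = b *\<^sub>R u"
    using u[of "c *\<^sub>R \<phi> p (\<phi> p w) + \<phi> p w"] by auto
  then have "c *\<^sub>R \<phi> p (\<phi> p w) + \<phi> p w = (b / a) *\<^sub>R Y p"
    using a \<open>a \<noteq> 0\<close> by simp
  then have "g p (H Y p) (c *\<^sub>R \<phi> p (\<phi> p w) + \<phi> p w) = 0"
    using \<open>G Y (H Y) p = 0\<close> g_sym[of "Y p" p "H Y p"] by (simp add: bilin_at_def)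
  \<comment> \<open>The two eigencomponents add up to 2c \<phi>(\<phi>w), which differs from a
    multiple of w only along \<xi>.\<close>
  with same have "c * g p (H Y p) (\<phi> p (\<phi> p w)) = 0"
    by simp
  then have "g p (H Y p) (\<phi> p (\<phi> p w)) = 0"
    using c by auto
  then show "g p (H Y p) w = 0"
    using \<eta>H g_\<xi>[of "H Y p" p] g_sym[of "H Y p" p "\<xi> p"] by (simp add: \<phi>_\<phi>)
qed

text \<open>Near a point where \<open>H Y\<close> does not vanish, \<open>Y\<close> vanishes identically, hence so does
  \<open>[\<xi>, Y]\<close>. Locality of the derivation \<open>\<xi> p\<close> is obtained from the Leibniz rule for
  \<open>(Y h) ((H Y) f) = 0\<close> in place of a bump function.\<close>

lemma H_eigenfield_zero:
  assumes c: "c = 1 \<or> c = - 1" and [simp]: "Y \<in> VF" and PY: "P Y = c *\<^sub>R Y"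
    and G: "G Y (H Y) = 0"
  shows "H Y = 0"
proof (rule VF_eqI)
  fix p f assume [simp]: "f \<in> SF"
  show "H Y p f = (0 :: 'a vfield) p f"
  proof (rule ccontr)
    assume "H Y p f \<noteq> (0 :: 'a vfield) p f"
    then have F: "D (H Y) f p \<noteq> 0"
      by (simp add: deriv_along_def)
    have zero: "H Y q = 0" if "Y q \<noteq> 0" for q
      using H_eigenfield_zero_at[OF c _ PY _ that] G by simp
    have Yp: "Y p = 0"
      by (rule ccontr) (use F zero[of p] in \<open>simp add: deriv_along_def\<close>)
    have "\<xi> p (D Y h) = 0" if [simp]: "h \<in> SF" for h
    proof -
      have "D Y h * D (H Y) f = 0"
        using zero by (auto simp: fun_eq_iff deriv_along_def)
      then have "0 = \<xi> p (D Y h) * D (H Y) f p + D Y h p * \<xi> p (D (H Y) f)"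
        using tangent_mult[of "\<xi> p" p "D Y h" "D (H Y) f"] tangent_zero[of "\<xi> p" p] by simp
      with F Yp show ?thesis
        by (simp add: deriv_along_def)
    qed
    then have "B \<xi> Y p = 0"
      using Yp by (intro tangent_eqI[OF VF_tangent[OF VF_bracket]]) (simp_all add: lie_bracket_def)
    then have "H Y p = 0"
      by (simp add: H_def PY bracket_scaleR_right endo_at_def[of _ "B \<xi> Y"])
    with F show False
      by (simp add: deriv_along_def)
  qed
qed simp_all

text \<open>L_\<xi> g = 0 makes HY orthogonal to all vector fields, whereas nondegeneracy tests
  against all tangent vectors. Splitting X into \<xi>- and eigencomponents avoids extending tangent
  vectors to fields.\<close>

lemma Killing_imp_H_zero:
  assumes K: "Killing A g \<xi>" and [simp]: "X \<in> VF"
  shows "H X = 0"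
proof -
  have GH: "G X (H Y) = 0" if "X \<in> VF" "Y \<in> VF" for X Y
    using K T_P[OF that] that by (simp add: Killing_def)
  define Q where "Q c = (1 / 2) *\<^sub>R (P (P X) + c *\<^sub>R P X)" for c
  have Q [simp]: "Q c \<in> VF" and PQ: "c = 1 \<or> c = - 1 \<Longrightarrow> P (Q c) = c *\<^sub>R Q c" for c
    using eigen_decomposition(2,3)[of X c] by (simp_all add: Q_def)
  have HQ: "H (Q c) = 0" if "c = 1 \<or> c = - 1" for c
    using H_eigenfield_zero[OF that _ PQ[OF that]] GH by simp
  have "H \<xi> = 0"
    by (simp add: H_def)
  moreover have "H X = H (fmult (e X) \<xi> + Q 1 + Q (- 1))"
    using eigen_decomposition(1)[of X] by (simp add: Q_def)
  ultimately show ?thesis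
    by (simp add: H_add H_fmult HQ)
qed

text \<open>The normality tensor, with \<open>d\<eta>\<close> replaced by the pointwise expression \<open>g(\<cdot>, \<phi>\<cdot>)\<close>.\<close>

definition N :: "'a vfield \<Rightarrow> 'a vfield \<Rightarrow> 'a vfield" where
  "N X Y = nijenhuis \<phi> X Y - fmult (2 *\<^sub>R G X (P Y)) \<xi>"

lemma N_anti:
  assumes [simp]: "X \<in> VF" "Y \<in> VF"
  shows "N Y X = - N X Y"
proof -
  have "G Y (P X) = - G X (P Y)"
    using G_P[of X Y] G_sym[of Y "P X"] by simp
  moreover have "fmult (2 *\<^sub>R - a) \<xi> = - fmult (2 *\<^sub>R a) \<xi>" for a
    by (auto simp: fmult_def fun_eq_iff)
  ultimately show ?thesis
    by (simp add: N_def nijenhuis_def bracket_anti[of Y] bracket_anti[of "P Y"] P_minus)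
qed

text \<open>The derivatives of a in the brackets cancel in pairs, and the d\<eta> term is pointwise
  in the form g(., \<phi>.). Tensoriality lets N be checked on eigencomponents.\<close>

lemma N_fmult_left:
  assumes [simp]: "X \<in> VF" "Y \<in> VF" "a \<in> SF"
  shows "N (fmult a X) Y = fmult a (N X Y)"
  by (rule ext) (simp add: N_def nijenhuis_def P_fmult P_diff bracket_fmult_left G_fmult_left,
      simp add: fmult_def algebra_simps)

lemma N_add_left:
  assumes [simp]: "X \<in> VF" "Y \<in> VF" "Z \<in> VF"
  shows "N (X + Y) Z = N X Z + N Y Z"
  by (rule ext) (simp add: N_def nijenhuis_def P_add bracket_add_left G_add_left,
      simp add: fmult_def algebra_simps)

lemma N_add_right:
  assumes [simp]: "X \<in> VF" "Y \<in> VF" "Z \<in> VF"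
  shows "N Z (X + Y) = N Z X + N Z Y"
  using N_add_left[of X Y Z] by (simp add: N_anti[of _ Z])

lemma N_fmult_right:
  assumes [simp]: "X \<in> VF" "Y \<in> VF" "a \<in> SF"
  shows "N Y (fmult a X) = fmult a (N Y X)"
  by (simp add: N_anti[of X Y] N_anti[of "fmult a X" Y] N_fmult_left fmult_minus)

lemma N_\<xi>:
  assumes "\<And>X. X \<in> VF \<Longrightarrow> H X = 0" and [simp]: "X \<in> VF"
  shows "N \<xi> X = 0"
proof -
  have "B \<xi> (P X) = P (B \<xi> X)"
    using assms(1)[of X] by (simp add: H_def)
  then show ?thesis
    by (simp add: N_def nijenhuis_def)
qed

text \<open>The two mixed brackets cancel, and \<phi>^2 [X, Y] + [\<phi>X, \<phi>Y] =
  -\<eta>([X, Y]) \<xi>. As \<eta>(X) = \<eta>(Y) = 0, this equals 2 d\<eta>(X, Y) \<xi>.\<close>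

lemma N_eigenfields_opposite:
  assumes c: "c = 1 \<or> c = - 1" and [simp]: "X \<in> VF" "Y \<in> VF"
    and PX: "P X = c *\<^sub>R X" and PY: "P Y = - c *\<^sub>R Y"
  shows "N X Y = 0"
proof -
  have e: "e X = 0" "e Y = 0"
    using e_P[of X] e_P[of Y] e_scaleR[of X c] e_scaleR[of Y "- c"] PX PY c by auto
  have "2 * G X (P Y) p = - e (B X Y) p" for p
    using contact[of X Y p] by (simp add: e)
  then have "2 *\<^sub>R G X (P Y) = - e (B X Y)"
    by (simp add: fun_eq_iff)
  then have "N X Y = P (P (B X Y)) + B (P X) (P Y) - P (B (P X) Y) - P (B X (P Y)) + fmult (e (B X Y)) \<xi>"
    by (simp add: N_def nijenhuis_def) (simp add: fmult_def fun_eq_iff)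
  also have "\<dots> = 0"
    using c by (auto simp: P_P PX PY bracket_scaleR_left bracket_scaleR_right
        bracket_minus_left bracket_minus_right P_minus P_scaleR algebra_simps)
  finally show ?thesis .
qed

text \<open>By proportionality (Y f) N(X, Y) = (X f) N(Y, Y) = 0, and likewise with X f in front.
  This settles points where some such coefficient is nonzero; elsewhere X and Y both vanish.\<close>

lemma N_eigenfields_same:
  assumes c: "c = 1 \<or> c = - 1" and [simp]: "X \<in> VF" "Y \<in> VF"
    and PX: "P X = c *\<^sub>R X" and PY: "P Y = c *\<^sub>R Y"
  shows "N X Y = 0"
proof
  fix p
  have self: "N Z Z = 0" if "Z \<in> VF" for Z
    using N_anti[OF that that] by (simp add: eq_neg_iff_add_eq_0 flip: scaleR_2)
  have *: "D Y f p *\<^sub>R N X Y p = 0" "D X f p *\<^sub>R N X Y p = 0" if [simp]: "f \<in> SF" for f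
  proof -
    have "fmult (D Y f) X = fmult (D X f) Y"
      by (rule eigenfields_proportional[OF c]) (simp_all add: PX PY)
    then have "fmult (D Y f) (N X Y) = fmult (D X f) (N Y Y)"
      and "fmult (D X f) (N X Y) = fmult (D Y f) (N X X)"
      using N_fmult_left[of X Y "D Y f"] N_fmult_left[of Y Y "D X f"]
        N_fmult_right[of Y X "D X f"] N_fmult_right[of X X "D Y f"] by simp_all
    then have "fmult (D Y f) (N X Y) p = 0" "fmult (D X f) (N X Y) p = 0"
      by (simp_all add: self)
    then show "D Y f p *\<^sub>R N X Y p = 0" "D X f p *\<^sub>R N X Y p = 0"
      by (simp_all only: fmult_def)
  qed
  show "N X Y p = (0 :: 'a vfield) p"
  proof (cases "\<exists>f\<in>SF. D X f p \<noteq> 0 \<or> D Y f p \<noteq> 0")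
    case True
    with * show ?thesis
      by auto
  next
    case False
    then have zero: "X p = 0" "Y p = 0"
      by (auto intro!: tangent_eqI[of _ p] simp: deriv_along_def)
    \<comment> \<open>Each term of the bracket at p is a derivative along X p or Y p. All brackets
      in N are multiples of [X, Y], so nothing survives.\<close>
    then have "B X Y p = 0" "G X (P Y) p = 0"
      by (simp_all add: bilin_at_def endo_at_def) (simp add: lie_bracket_def fun_eq_iff)
    then show ?thesis
      by (simp add: N_def nijenhuis_def PX PY bracket_scaleR_left bracket_scaleR_right
          P_scaleR) (simp add: fmult_def endo_at_def)
  qed
qed

text \<open>Expands N bilinearly over \<xi> and the two eigencomponents of each argument.\<close>

lemma normal_if_H_zero:
  assumes H: "\<And>X. X \<in> VF \<Longrightarrow> H X = 0"
  shows "normal_structure A \<phi> \<xi> \<eta>"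
proof -
  define Q where "Q X c = (1 / 2) *\<^sub>R (P (P X) + c *\<^sub>R P X)" for X c
  have Q [simp]: "Q X c \<in> VF" and PQ: "c = 1 \<or> c = - 1 \<Longrightarrow> P (Q X c) = c *\<^sub>R Q X c"
    and X: "X = fmult (e X) \<xi> + Q X 1 + Q X (- 1)" if "X \<in> VF" for X c
    using eigen_decomposition[OF that] by (simp_all add: Q_def)
  have N_\<xi>': "N X \<xi> = 0" if "X \<in> VF" for X
    using N_\<xi>[OF H that] N_anti[of \<xi> X] that by simp
  have "N X Y = 0" if [simp]: "X \<in> VF" "Y \<in> VF" for X Y
  proof -
    have NQ: "N (Q X c) (Q Y d) = 0" if "c = 1 \<or> c = - 1" "d = 1 \<or> d = - 1" for c d
      using that N_eigenfields_same[of c "Q X c" "Q Y d"] N_eigenfields_opposite[of c "Q X c" "Q Y d"]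
        PQ[of X c] PQ[of Y d] by auto
    have "N X Y = N (fmult (e X) \<xi> + Q X 1 + Q X (- 1)) (fmult (e Y) \<xi> + Q Y 1 + Q Y (- 1))"
      using X[of X] X[of Y] by simp
    also have "\<dots> = 0"
      by (simp add: N_add_left N_add_right N_fmult_left N_fmult_right N_\<xi>[OF H] N_\<xi>' NQ)
    finally show ?thesis .
  qed
  moreover have "ext_deriv \<eta> X Y = G X (P Y)" if "X \<in> VF" "Y \<in> VF" for X Y
    using paracontact_metric that by (simp add: paracontact_metric_def)
  ultimately show ?thesis
    by (simp add: normal_structure_def N_def)
qed

end

theorem theorem3p3:
  fixes A :: "('a::{t2_space, second_countable_topology}, 3) chart set"
    and \<phi> :: "'a \<Rightarrow> 'a tangent \<Rightarrow> 'a tangent"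
    and \<xi> :: "'a vfield"
    and \<eta> :: "'a \<Rightarrow> 'a tangent \<Rightarrow> real"
    and g :: "'a \<Rightarrow> 'a tangent \<Rightarrow> 'a tangent \<Rightarrow> real"
    and nabla :: "'a vfield \<Rightarrow> 'a vfield \<Rightarrow> 'a vfield"
  assumes "paracontact_metric A \<phi> \<xi> \<eta> g"
    and "levi_civita A g nabla"
    and "affine_Killing A nabla \<xi>"
  shows "Killing A g \<xi> \<and> paraSasakian A \<phi> \<xi> \<eta> g"
proof -
  interpret paracontact_manifold A \<phi> \<xi> \<eta> g
    by unfold_locales (fact assms(1))
  have "Killing A g \<xi>"
    using affine_Killing_imp_Killing assms(2,3) .
  moreover from this have "normal_structure A \<phi> \<xi> \<eta>"
    using Killing_imp_H_zero normal_if_H_zero by blast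
  ultimately show ?thesis
    using assms(1) by (simp add: paraSasakian_def)
qed

end
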